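(* Consider Witsenhausen's counterexample with cost parameter $\lambda>0$ and optimal cost $J^*$. There exists a sequence of finite models, obtained through a successive refinement of the measurement and action set partitions generated by uniform quantizers, whose optimal costs converge to $J^*$. That is, there exist sequences $(l_j,n_j,m_j,k_j)_{j\ge1}$, with $l_j,m_j>0$ real and $n_j,k_j\ge1$ integers, such that for every $j$ the measurement partition $\mathcal A(l_{j+1},n_{j+1})$ refines $\mathcal A(l_j,n_j)$ and the action partition $\mathcal A(m_{j+1},k_{j+1})$ refines $\mathcal A(m_j,k_j)$ (up to the finitely many cell boundary points), and $$\lim_{j\to\infty}\ \inf_{(\pi^1,\pi^2)\in\mathbf\Pi_{l_j,n_j}^{m_j,k_j}}J_{l_j,n_j}(\pi^1,\pi^2)=J^*.$$
   Context: Witsenhausen's counterexample: $y^1$ and $v$ are independent standard Gaussian random variables; Agent 1 observes $y^1$ and plays $u^1=\gamma^1(y^1)$; Agent 2 observes $y^2=u^1+v$ and plays $u^2=\gamma^2(y^2)$, with $\gamma^1,\gamma^2:\mathbb R\to\mathbb R$ Borel measurable. $J(\gamma^1,\gamma^2)=E[\lambda(u^1-y^1)^2+(u^2-u^1)^2]$ and $J^*=\inf_{\gamma^1,\gamma^2}J(\gamma^1,\gamma^2)$. Let $f(u,y)=\exp\{-(u^2-2yu)/2\}$ and $\tilde c(y^1,y^2,u^1,u^2)=(\lambda(u^1-y^1)^2+(u^2-u^1)^2)f(u^1,y^2)$; $\mathbb P_{\mathsf g}$ is the standard Gaussian law. Uniform quantizers: for real $a>0$ and integer $r\ge1$, the uniform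 quantizer on $[-a,a]$ with $r$ output levels maps each of the $r$ consecutive intervals of length $2a/r$ partitioning $[-a,a]$ to its midpoint. $\mathcal A(a,r)$ denotes the partition of $\mathbb R$ into these $r$ intervals together with $\mathbb R\setminus[-a,a]$. Finite models: $q_{l,n}:\mathbb R\to\mathbb R$ is the uniform quantizer on $[-l,l]$ with $n$ output levels $y_1,\dots,y_n$, extended by $q_{l,n}(y)=y_0:=0$ for $y\notin[-l,l]$; $\mathsf Z_{l,n}=\{y_0,y_1,\dots,y_n\}$; $\mathbb P_{l,n}=\mathbb P_{\mathsf g}\circ q_{l,n}^{-1}$; $\mathsf U_{m,k}=\{u_1,\dots,u_k\}$ is the set of output levels of the uniform quantizer on $[-m,m]$ with $k$ output levels; $\mathbf\Pi_{l,n}^{m,k}$ is the set of pairs $(\pi^1,\pi^2)$ of maps $\pi^i:\mathsf Z_{l,n}\to\mathsf U_{m,k}$; and $J_{l,n}(\pi^1,\pi^2)=\sum_{z,z'\in\mathsf Z_{l,n}}\tilde c(z,z',\pi^1(z),\pi^2(z'))\,\mathbb P_{l,n}(z)\mathbb P_{l,n}(z')$. *)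

theory Defs
  imports "HOL-Probability.Probability"
begin

section \<open>Witsenhausen's problem\<close>

definition std_gaussian :: "real measure" where
  "std_gaussian = density lborel std_normal_density"

definition stage_cost :: "real \<Rightarrow> real \<Rightarrow> real \<Rightarrow> real \<Rightarrow> real" where
  "stage_cost lam y1 u1 u2 = lam * (u1 - y1)\<^sup>2 + (u2 - u1)\<^sup>2"

text \<open>The expected cost is a nonnegative integral with values in \<^typ>\<open>ennreal\<close>: it is infinite
  for policies without enough moments, where the Bochner integral would return 0.\<close>

definition expected_cost :: "'w measure \<Rightarrow> ('w \<Rightarrow> real) \<Rightarrow> ('w \<Rightarrow> real) \<Rightarrow> real \<Rightarrow>
    (real \<Rightarrow> real) \<Rightarrow> (real \<Rightarrow> real) \<Rightarrow> ennreal" where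
  "expected_cost M Y1 V lam g1 g2 =
     (\<integral>\<^sup>+ w. (let y1 = Y1 w; u1 = g1 y1; y2 = u1 + V w; u2 = g2 y2
             in ennreal (stage_cost lam y1 u1 u2)) \<partial>M)"

definition opt_cost :: "'w measure \<Rightarrow> ('w \<Rightarrow> real) \<Rightarrow> ('w \<Rightarrow> real) \<Rightarrow> real \<Rightarrow> ennreal" where
  "opt_cost M Y1 V lam =
     (INF (g1, g2) \<in> borel_measurable borel \<times> borel_measurable borel. expected_cost M Y1 V lam g1 g2)"

text \<open>The density, as a function of \<open>y\<close>, of the law of \<open>u + v\<close> with respect to that of \<open>v\<close>,
  for a standard Gaussian \<open>v\<close>.\<close>

definition likelihood_ratio :: "real \<Rightarrow> real \<Rightarrow> real" where
  "likelihood_ratio u y = exp (- (u\<^sup>2 - 2 * y * u) / 2)"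

definition c_tilde :: "real \<Rightarrow> real \<Rightarrow> real \<Rightarrow> real \<Rightarrow> real \<Rightarrow> real" where
  "c_tilde lam y1 y2 u1 u2 = stage_cost lam y1 u1 u2 * likelihood_ratio u1 y2"


section \<open>Uniform quantizers\<close>

text \<open>Cells are indexed by \<open>0, \<dots>, r - 1\<close> and are half-open, except that the last one
  contains the right end point \<open>a\<close>, so that they partition \<open>[-a, a]\<close>.\<close>

definition cell :: "real \<Rightarrow> nat \<Rightarrow> nat \<Rightarrow> real set" where
  "cell a r i = {- a + 2 * a * real i / real r ..< - a + 2 * a * real (i + 1) / real r}
                \<union> (if i + 1 = r then {a} else {})"

definition level :: "real \<Rightarrow> nat \<Rightarrow> nat \<Rightarrow> real" where
  "level a r i = - a + a * real (2 * i + 1) / real r"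

text \<open>The cells are disjoint, so at most one summand is nonzero; outside \<open>[-a, a]\<close> the value is 0.\<close>

definition quantizer :: "real \<Rightarrow> nat \<Rightarrow> real \<Rightarrow> real" where
  "quantizer a r y = (\<Sum>i<r. level a r i * indicator (cell a r i) y)"

definition quantizer_partition :: "real \<Rightarrow> nat \<Rightarrow> real set set" where
  "quantizer_partition a r = insert (- {- a..a}) (cell a r ` {..<r})"

text \<open>Cells need only be included up to the end points of the cells: with half-open cells,
  \<open>C - D\<close> can contain such a point even if the interior of \<open>C\<close> lies in \<open>D\<close>.\<close>

definition refines_upto_boundary :: "real set set \<Rightarrow> real set set \<Rightarrow> bool" where
  "refines_upto_boundary P Q \<longleftrightarrow> (\<forall>C\<in>P. \<exists>D\<in>Q. C - D \<subseteq> (\<Union>E\<in>P \<union> Q. frontier E))"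

lemma cells_cover:
  assumes "a > 0" "r \<ge> 1"
  shows "(\<Union>i<r. cell a r i) = {- a..a}"
proof (intro equalityI subsetI)
  fix y assume "y \<in> (\<Union>i<r. cell a r i)"
  then obtain i where i: "i < r" and y: "y \<in> cell a r i" by auto
  show "y \<in> {- a..a}"
  proof (cases "y = a")
    case True
    then show ?thesis using assms by simp
  next
    case False
    then have lo: "- a + 2 * a * real i / real r \<le> y"
      and hi: "y < - a + 2 * a * real (i + 1) / real r"
      using y by (auto simp: cell_def split: if_splits)
    have "2 * a * real (i + 1) \<le> 2 * a * real r"
      using i assms by (intro mult_left_mono) auto
    then have "2 * a * real (i + 1) / real r \<le> 2 * a"
      using assms by (simp add: divide_le_eq)
    moreover have "0 \<le> 2 * a * real i / real r" using assms by simp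
    ultimately show ?thesis using lo hi by simp
  qed
next
  fix y assume y: "y \<in> {- a..a}"
  show "y \<in> (\<Union>i<r. cell a r i)"
  proof (cases "y = a")
    case True
    then have "y \<in> cell a r (r - 1)" using assms by (simp add: cell_def)
    moreover have "r - 1 < r" using assms by simp
    ultimately show ?thesis by blast
  next
    case False
    define t where "t = (y + a) * real r / (2 * a)"
    define i where "i = nat \<lfloor>t\<rfloor>"
    have t0: "0 \<le> t" using y assms by (simp add: t_def)
    have "(y + a) * real r < 2 * a * real r"
      using y False assms by (intro mult_strict_right_mono) auto
    then have tr: "t < real r"
      using assms by (simp add: t_def divide_less_eq mult.commute)
    have it: "real i \<le> t" "t < real (i + 1)"
      using t0 by (simp_all add: i_def of_nat_nat) linarith
    have yt: "y = - a + 2 * a * t / real r"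
      using assms by (simp add: t_def)
    have "2 * a * real i / real r \<le> 2 * a * t / real r"
      using it assms by (intro divide_right_mono mult_left_mono) auto
    moreover have "2 * a * t / real r < 2 * a * real (i + 1) / real r"
      using it assms by (intro divide_strict_right_mono mult_strict_left_mono) auto
    ultimately have "y \<in> cell a r i" by (simp add: cell_def yt)
    moreover have "i < r" using it tr by linarith
    ultimately show ?thesis by blast
  qed
qed


section \<open>Finite models\<close>

text \<open>\<open>meas_levels l n\<close> is a set of points: for odd \<open>n\<close> the value \<open>0\<close> assigned outside \<open>[-l, l]\<close> is also
  the middle output level, and its mass under \<open>quantized_gaussian l n\<close> is that of both regions together.\<close>

definition meas_levels :: "real \<Rightarrow> nat \<Rightarrow> real set" where
  "meas_levels l n = insert 0 (level l n ` {..<n})"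

definition act_levels :: "real \<Rightarrow> nat \<Rightarrow> real set" where
  "act_levels m k = level m k ` {..<k}"

definition quantized_gaussian :: "real \<Rightarrow> nat \<Rightarrow> real measure" where
  "quantized_gaussian l n = distr std_gaussian borel (quantizer l n)"

definition policies :: "real \<Rightarrow> nat \<Rightarrow> real \<Rightarrow> nat \<Rightarrow> ((real \<Rightarrow> real) \<times> (real \<Rightarrow> real)) set" where
  "policies l n m k = (meas_levels l n \<rightarrow>\<^sub>E act_levels m k) \<times> (meas_levels l n \<rightarrow>\<^sub>E act_levels m k)"

definition finite_cost :: "real \<Rightarrow> real \<Rightarrow> nat \<Rightarrow> (real \<Rightarrow> real) \<Rightarrow> (real \<Rightarrow> real) \<Rightarrow> real" where
  "finite_cost lam l n p1 p2 =
     (\<Sum>z\<in>meas_levels l n. \<Sum>z'\<in>meas_levels l n.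
        c_tilde lam z z' (p1 z) (p2 z') * measure (quantized_gaussian l n) {z} * measure (quantized_gaussian l n) {z'})"

end

(*
  A change of measure makes the observation y2 = u1 + v a standard Gaussian independent of y1: the
  expected cost is the integral of c_tilde(y1, y2, g1 y1, g2 y2) over two independent Gaussians, and the
  integrand is now continuous in the actions.

  Upper bound: a limit of finite optimal costs is at most the cost of any pair of bounded continuous
  policies, since composing those with the quantizers gives finite policies converging pointwise. Bounded
  measurable policies are almost everywhere limits of bounded continuous ones, and general policies
  of finite cost are reached by cutting off first g1 and then g2, each time by dominated convergence.

  Lower bound: finite policies composed with the measurement quantizer are policies of the original
  problem, and for a fixed finite action set the cost changes by at most the sum over all action pairs
  of the L1 quantization errors of c_tilde. The j-th model uses the dyadic action grid of index j and a
  dyadic measurement grid so fine that this sum is at most 1 / (j + 1).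
*)

theory Submission
  imports Defs
begin

section \<open>The cost as an integral over independent observations\<close>

text \<open>Here the law of the observations no longer depends on the policies: the influence of
  \<open>g1\<close> on the second observation is carried by the likelihood factor inside
  \<open>c_tilde\<close>.\<close>

definition independent_cost :: "real \<Rightarrow> (real \<Rightarrow> real) \<Rightarrow> (real \<Rightarrow> real) \<Rightarrow> ennreal" where
  "independent_cost lam g1 g2 = (\<integral>\<^sup>+ w. ennreal (c_tilde lam (fst w) (snd w) (g1 (fst w)) (g2 (snd w)))
     \<partial>(std_gaussian \<Otimes>\<^sub>M std_gaussian))"

lemma sets_std_gaussian [simp, measurable_cong]: "sets std_gaussian = sets borel"
  and space_std_gaussian [simp]: "space std_gaussian = UNIV"
  by (simp_all add: std_gaussian_def)

lemma prob_space_std_gaussian: "prob_space std_gaussian"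
  unfolding std_gaussian_def by (rule prob_space_normal_density) simp

interpretation gauss: prob_space std_gaussian
  by (rule prob_space_std_gaussian)

interpretation gauss2: pair_prob_space std_gaussian std_gaussian ..

lemma measurable_c_tilde [measurable (raw)]:
  assumes [measurable]: "a \<in> borel_measurable M" "b \<in> borel_measurable M"
    "c \<in> borel_measurable M" "d \<in> borel_measurable M"
  shows "(\<lambda>x. c_tilde lam (a x) (b x) (c x) (d x)) \<in> borel_measurable M"
  unfolding c_tilde_def stage_cost_def likelihood_ratio_def by measurable

lemma measurable_likelihood_ratio [measurable (raw)]:
  assumes [measurable]: "a \<in> borel_measurable M" "b \<in> borel_measurable M"
  shows "(\<lambda>x. likelihood_ratio (a x) (b x)) \<in> borel_measurable M"
  unfolding likelihood_ratio_def by measurable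

lemma measurable_stage_cost [measurable (raw)]:
  assumes [measurable]: "a \<in> borel_measurable M" "b \<in> borel_measurable M" "c \<in> borel_measurable M"
  shows "(\<lambda>x. stage_cost lam (a x) (b x) (c x)) \<in> borel_measurable M"
  unfolding stage_cost_def by measurable

lemma likelihood_ratio_pos: "likelihood_ratio u y > 0"
  by (simp add: likelihood_ratio_def)

lemma stage_cost_nonneg: "lam \<ge> 0 \<Longrightarrow> stage_cost lam y1 u1 u2 \<ge> 0"
  by (simp add: stage_cost_def)

lemma c_tilde_nonneg: "lam \<ge> 0 \<Longrightarrow> c_tilde lam y1 y2 u1 u2 \<ge> 0"
  by (simp add: c_tilde_def stage_cost_nonneg less_imp_le[OF likelihood_ratio_pos])

text \<open>Completing the square: \<open>-(x - u)^2 / 2\<close> splits into the exponent of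
  \<open>likelihood_ratio\<close> and \<open>-x^2 / 2\<close>.\<close>

lemma std_normal_density_shift:
  "std_normal_density (x - u) = likelihood_ratio u x * std_normal_density x"
proof -
  have "exp (- (x - u)\<^sup>2 / 2) = exp (- (u\<^sup>2 - 2 * x * u) / 2 + (- x\<^sup>2 / 2))"
    by (rule arg_cong[of _ _ exp]) (simp add: power2_eq_square field_simps)
  then show ?thesis
    unfolding std_normal_density_def likelihood_ratio_def exp_add by simp
qed

text \<open>The Cameron-Martin formula in dimension one: translation invariance of Lebesgue measure
  moves the shift from \<open>h\<close> to the density.\<close>

lemma nn_integral_std_gaussian_shift:
  assumes [measurable]: "h \<in> borel_measurable borel"
  shows "(\<integral>\<^sup>+ v. h (u + v) \<partial>std_gaussian) = (\<integral>\<^sup>+ y. h y * ennreal (likelihood_ratio u y) \<partial>std_gaussian)"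
proof -
  have "(\<integral>\<^sup>+ v. h (u + v) \<partial>std_gaussian) = (\<integral>\<^sup>+ v. ennreal (std_normal_density v) * h (u + v) \<partial>lborel)"
    unfolding std_gaussian_def by (rule nn_integral_density) auto
  also have "\<dots> = (\<integral>\<^sup>+ x. ennreal (std_normal_density (x - u)) * h x \<partial>lborel)"
    by (subst nn_integral_real_affine[where c = 1 and t = "-u"]) (auto simp: one_ennreal_def[symmetric])
  also have "\<dots> = (\<integral>\<^sup>+ x. ennreal (std_normal_density x) * (h x * ennreal (likelihood_ratio u x)) \<partial>lborel)"
    by (intro nn_integral_cong)
      (simp add: std_normal_density_shift ennreal_mult less_imp_le[OF likelihood_ratio_pos] ac_simps)
  also have "\<dots> = (\<integral>\<^sup>+ y. h y * ennreal (likelihood_ratio u y) \<partial>std_gaussian)"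
    unfolding std_gaussian_def by (rule nn_integral_density[symmetric]) auto
  finally show ?thesis .
qed

text \<open>The shift formula for \<open>h = 1\<close>. As the value does not depend on
  \<open>u\<close>, it also controls integrals in which \<open>u\<close> is an unbounded function of
  the first observation.\<close>

lemma nn_integral_likelihood_ratio: "(\<integral>\<^sup>+ y. ennreal (likelihood_ratio u y) \<partial>std_gaussian) = 1"
  using nn_integral_std_gaussian_shift[of "\<lambda>_. 1" u] gauss.emeasure_space_1 by simp

lemma expected_cost_eq_independent_cost:
  fixes lam :: real and M :: "'w measure" and Y1 V :: "'w \<Rightarrow> real"
  assumes "lam > 0"
    and "prob_space M"
    and Y: "distributed M lborel Y1 std_normal_density"
    and V: "distributed M lborel V std_normal_density"
    and ind: "prob_space.indep_var M borel Y1 borel V"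
    and g [measurable]: "g1 \<in> borel_measurable borel" "g2 \<in> borel_measurable borel"
  shows "expected_cost M Y1 V lam g1 g2 = independent_cost lam g1 g2"
proof -
  interpret prob_space M by fact
  have [measurable]: "Y1 \<in> borel_measurable M" "V \<in> borel_measurable M"
    using distributed_measurable[OF Y] distributed_measurable[OF V] by auto
  \<comment> \<open>The densities are given relative to \<open>lborel\<close>, independence relative
    to \<open>borel\<close>; the two have the same measurable sets.\<close>
  have "distr M borel Y1 = distr M lborel Y1" "distr M borel V = distr M lborel V"
    by (auto intro!: distr_cong)
  then have dY: "distr M borel Y1 = std_gaussian" and dV: "distr M borel V = std_gaussian"
    using distributed_distr_eq_density[OF Y] distributed_distr_eq_density[OF V]
    by (simp_all add: std_gaussian_def)
  have joint: "distr M (borel \<Otimes>\<^sub>M borel) (\<lambda>x. (Y1 x, V x)) = std_gaussian \<Otimes>\<^sub>M std_gaussian"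
    using ind unfolding indep_var_distribution_eq dY dV by simp
  have "expected_cost M Y1 V lam g1 g2 =
      (\<integral>\<^sup>+ w. ennreal (stage_cost lam (fst (Y1 w, V w)) (g1 (fst (Y1 w, V w))) (g2 (g1 (fst (Y1 w, V w)) + snd (Y1 w, V w)))) \<partial>M)"
    unfolding expected_cost_def by (simp add: Let_def)
  also have "\<dots> = (\<integral>\<^sup>+ w. ennreal (stage_cost lam (fst w) (g1 (fst w)) (g2 (g1 (fst w) + snd w)))
      \<partial>distr M (borel \<Otimes>\<^sub>M borel) (\<lambda>x. (Y1 x, V x)))"
    by (rule nn_integral_distr[symmetric]) measurable
  also have "\<dots> = (\<integral>\<^sup>+ y. \<integral>\<^sup>+ v. ennreal (stage_cost lam y (g1 y) (g2 (g1 y + v))) \<partial>std_gaussian \<partial>std_gaussian)"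
    unfolding joint by (subst gauss.nn_integral_fst[symmetric]) auto
  \<comment> \<open>In the inner integral \<open>y\<close> is fixed, so \<open>g1 y\<close> is a
    constant shift.\<close>
  also have "\<dots> = (\<integral>\<^sup>+ y. \<integral>\<^sup>+ y'. ennreal (c_tilde lam y y' (g1 y) (g2 y')) \<partial>std_gaussian \<partial>std_gaussian)"
  proof (rule nn_integral_cong)
    show "(\<integral>\<^sup>+ v. ennreal (stage_cost lam y (g1 y) (g2 (g1 y + v))) \<partial>std_gaussian) =
        (\<integral>\<^sup>+ y'. ennreal (c_tilde lam y y' (g1 y) (g2 y')) \<partial>std_gaussian)" for y
      using nn_integral_std_gaussian_shift[of "\<lambda>x. ennreal (stage_cost lam y (g1 y) (g2 x))" "g1 y"] \<open>lam > 0\<close>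
      by (simp add: c_tilde_def ennreal_mult stage_cost_nonneg less_imp_le[OF likelihood_ratio_pos])
  qed
  also have "\<dots> = independent_cost lam g1 g2"
    unfolding independent_cost_def by (subst gauss.nn_integral_fst[symmetric]) auto
  finally show ?thesis .
qed

section \<open>Domination\<close>

text \<open>Since \<open>likelihood_ratio C y = exp (C * y - C^2 / 2)\<close>, exponential moments
  reduce to integrals of likelihood ratios with \<open>C = B\<close> and \<open>C = -B\<close>, each
  equal to 1.\<close>

lemma nn_integral_exp_abs_finite: "(\<integral>\<^sup>+ y. ennreal (exp (B * \<bar>y\<bar>)) \<partial>std_gaussian) < \<infinity>"
proof -
  have "exp (B * \<bar>y\<bar>) \<le> exp (B\<^sup>2 / 2) * (likelihood_ratio B y + likelihood_ratio (- B) y)" for y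
  proof -
    have e: "exp (B\<^sup>2 / 2) * likelihood_ratio C y = exp (C * y)" if "C\<^sup>2 = B\<^sup>2" for C
      unfolding likelihood_ratio_def exp_add[symmetric] using that by (simp add: field_simps)
    have "exp (B * \<bar>y\<bar>) \<le> exp (B * y) + exp (- B * y)"
      by (cases "y \<ge> 0") (auto simp: add_increasing add_increasing2)
    then show ?thesis using e[of B] e[of "-B"] by (simp add: distrib_left)
  qed
  then have "(\<integral>\<^sup>+ y. ennreal (exp (B * \<bar>y\<bar>)) \<partial>std_gaussian) \<le>
      (\<integral>\<^sup>+ y. ennreal (exp (B\<^sup>2 / 2)) * (ennreal (likelihood_ratio B y) + ennreal (likelihood_ratio (- B) y)) \<partial>std_gaussian)"
    by (intro nn_integral_mono)
      (simp add: ennreal_mult[symmetric] ennreal_plus[symmetric] less_imp_le[OF likelihood_ratio_pos] del: ennreal_plus)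
  also have "\<dots> = ennreal (exp (B\<^sup>2 / 2)) * 2"
    by (simp add: nn_integral_cmult nn_integral_add nn_integral_likelihood_ratio)
  also have "\<dots> < \<infinity>" by (simp add: ennreal_mult_less_top)
  finally show ?thesis .
qed

text \<open>A function of the first observation times one of the second, so that the integral
  factorizes. The first exponential majorizes the quadratic growth of the stage cost, the others the
  likelihood ratio for actions bounded by \<open>B\<close>, with room for observations displaced by
  quantization.\<close>

definition dominating_cost :: "real \<Rightarrow> real \<Rightarrow> real \<times> real \<Rightarrow> real" where
  "dominating_cost lam B w =
     (lam * (B + 1)\<^sup>2 + 4 * B\<^sup>2) * exp (2 * \<bar>fst w\<bar>) * (exp B * exp (B * \<bar>snd w\<bar>))"

lemma measurable_dominating_cost [measurable]:
  "dominating_cost lam B \<in> borel_measurable (borel \<Otimes>\<^sub>M borel)"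
  unfolding dominating_cost_def[abs_def] by measurable

lemma square_one_plus_abs_le: "(1 + \<bar>y\<bar>)\<^sup>2 \<le> exp (2 * \<bar>y\<bar>)" for y :: real
proof -
  have "(1 + \<bar>y\<bar>)\<^sup>2 \<le> (exp \<bar>y\<bar>)\<^sup>2"
    by (intro power_mono) (auto simp: exp_ge_add_one_self)
  then show ?thesis by (simp add: exp_of_nat_mult[symmetric] power2_eq_square exp_add[symmetric])
qed

text \<open>Letting \<open>z1\<close>, \<open>z2\<close> differ from \<open>y1\<close>,
  \<open>y2\<close> makes one integrable majorant serve the exact cost and all quantized costs at
  once.\<close>

lemma c_tilde_le_dominating_cost:
  assumes "lam \<ge> 0" "B \<ge> 0" "\<bar>u1\<bar> \<le> B" "\<bar>u2\<bar> \<le> B" "\<bar>z1\<bar> \<le> \<bar>y1\<bar> + 1" "\<bar>z2\<bar> \<le> \<bar>y2\<bar> + 1"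
  shows "c_tilde lam z1 z2 u1 u2 \<le> dominating_cost lam B (y1, y2)"
proof -
  have "(u1 - z1)\<^sup>2 \<le> ((B + 1) * (1 + \<bar>y1\<bar>))\<^sup>2"
  proof (rule power2_le_iff_abs_le[THEN iffD2])
    show "0 \<le> (B + 1) * (1 + \<bar>y1\<bar>)" using assms by simp
    have "\<bar>u1 - z1\<bar> \<le> B + 1 + \<bar>y1\<bar>" using assms by linarith
    also have "\<dots> \<le> (B + 1) * (1 + \<bar>y1\<bar>)" using assms by (simp add: algebra_simps)
    finally show "\<bar>u1 - z1\<bar> \<le> (B + 1) * (1 + \<bar>y1\<bar>)" .
  qed
  also have "\<dots> \<le> (B + 1)\<^sup>2 * exp (2 * \<bar>y1\<bar>)"
    unfolding power_mult_distrib by (intro mult_left_mono square_one_plus_abs_le) simp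
  finally have 1: "lam * (u1 - z1)\<^sup>2 \<le> lam * (B + 1)\<^sup>2 * exp (2 * \<bar>y1\<bar>)"
    using assms by (simp add: mult_left_mono mult.assoc)
  have "(u2 - u1)\<^sup>2 \<le> (2 * B)\<^sup>2"
    using assms by (intro power2_le_iff_abs_le[THEN iffD2]) auto
  also have "\<dots> \<le> 4 * B\<^sup>2 * exp (2 * \<bar>y1\<bar>)"
    by (simp add: power_mult_distrib mult_le_cancel_left1)
  finally have "stage_cost lam z1 u1 u2 \<le> (lam * (B + 1)\<^sup>2 + 4 * B\<^sup>2) * exp (2 * \<bar>y1\<bar>)"
    using 1 unfolding stage_cost_def by (simp add: distrib_right)
  moreover have "likelihood_ratio u1 z2 \<le> exp B * exp (B * \<bar>y2\<bar>)"
  proof -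
    have "z2 * u1 \<le> \<bar>z2\<bar> * \<bar>u1\<bar>" by (metis abs_ge_self abs_mult)
    also have "\<dots> \<le> (\<bar>y2\<bar> + 1) * B" using assms by (intro mult_mono) auto
    finally have "z2 * u1 \<le> B + B * \<bar>y2\<bar>" by (simp add: algebra_simps)
    \<comment> \<open>The term \<open>- u1^2 / 2\<close> of the exponent is nonpositive and is
      dropped.\<close>
    moreover have "- (u1\<^sup>2 - 2 * z2 * u1) / 2 \<le> z2 * u1" by simp
    ultimately have "- (u1\<^sup>2 - 2 * z2 * u1) / 2 \<le> B + B * \<bar>y2\<bar>" by linarith
    then show ?thesis unfolding likelihood_ratio_def exp_add[symmetric] by simp
  qed
  ultimately show ?thesis
    unfolding c_tilde_def dominating_cost_def fst_conv snd_conv using assms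
    by (intro mult_mono) (auto simp: less_imp_le[OF likelihood_ratio_pos])
qed

lemma nn_integral_pair_mult:
  assumes [measurable]: "f \<in> borel_measurable borel" "g \<in> borel_measurable borel"
  shows "(\<integral>\<^sup>+ w. f (fst w) * g (snd w) \<partial>(std_gaussian \<Otimes>\<^sub>M std_gaussian)) =
    (\<integral>\<^sup>+ x. f x \<partial>std_gaussian) * (\<integral>\<^sup>+ y. g y \<partial>std_gaussian)"
  by (subst gauss.nn_integral_fst[symmetric]) (auto simp: nn_integral_cmult nn_integral_multc)

lemma nn_integral_dominating_cost_finite:
  assumes "lam \<ge> 0"
  shows "(\<integral>\<^sup>+ w. ennreal (dominating_cost lam B w) \<partial>(std_gaussian \<Otimes>\<^sub>M std_gaussian)) < \<infinity>"
proof -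
  let ?K = "lam * (B + 1)\<^sup>2 + 4 * B\<^sup>2"
  have "(\<integral>\<^sup>+ w. ennreal (dominating_cost lam B w) \<partial>(std_gaussian \<Otimes>\<^sub>M std_gaussian)) =
      (\<integral>\<^sup>+ w. (ennreal ?K * ennreal (exp (2 * \<bar>fst w\<bar>))) * (ennreal (exp B) * ennreal (exp (B * \<bar>snd w\<bar>)))
        \<partial>(std_gaussian \<Otimes>\<^sub>M std_gaussian))"
    using assms unfolding dominating_cost_def by (simp add: ennreal_mult)
  also have "\<dots> < \<infinity>"
    by (subst nn_integral_pair_mult)
      (use nn_integral_exp_abs_finite[of 2] nn_integral_exp_abs_finite[of B] in
        \<open>auto simp: nn_integral_cmult ennreal_mult_less_top\<close>)
  finally show ?thesis .
qed

text \<open>Both marginals of the product are \<open>std_gaussian\<close>, so the preimages of a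
  null set under the two projections are null.\<close>

lemma AE_fst_snd_std_gaussian:
  assumes "AE x in std_gaussian. P x"
  shows "AE w in std_gaussian \<Otimes>\<^sub>M std_gaussian. P (fst w) \<and> P (snd w)"
proof -
  have 1: "AE w in std_gaussian \<Otimes>\<^sub>M std_gaussian. P (fst w)"
  proof (rule AE_distrD[where f = fst and M' = std_gaussian])
    show "AE x in distr (std_gaussian \<Otimes>\<^sub>M std_gaussian) std_gaussian fst. P x"
      unfolding gauss.distr_pair_fst by (rule assms)
  qed simp
  have distr_snd: "distr (std_gaussian \<Otimes>\<^sub>M std_gaussian) std_gaussian snd = std_gaussian"
    by (subst gauss2.distr_pair_swap) (simp add: distr_distr o_def gauss.distr_pair_fst split_beta')
  have 2: "AE w in std_gaussian \<Otimes>\<^sub>M std_gaussian. P (snd w)"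
  proof (rule AE_distrD[where f = snd and M' = std_gaussian])
    show "AE x in distr (std_gaussian \<Otimes>\<^sub>M std_gaussian) std_gaussian snd. P x"
      unfolding distr_snd by (rule assms)
  qed simp
  show ?thesis using 1 2 by eventually_elim simp
qed

section \<open>Limits of costs by dominated convergence\<close>

lemma tendsto_c_tilde:
  assumes "(a \<longlongrightarrow> a') F" "(b \<longlongrightarrow> b') F" "(c \<longlongrightarrow> c') F" "(d \<longlongrightarrow> d') F"
  shows "((\<lambda>x. c_tilde lam (a x) (b x) (c x) (d x)) \<longlongrightarrow> c_tilde lam a' b' c' d') F"
  unfolding c_tilde_def stage_cost_def likelihood_ratio_def
  by (intro tendsto_intros assms) auto

text \<open>Used twice: with quantizers \<open>q\<close> and quantized policies for the upper bound,
  and with \<open>q\<close> the identity to replace bounded measurable policies by continuous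
  ones.\<close>

lemma bounded_cost_tendsto:
  assumes "lam \<ge> 0" "B \<ge> 0"
    and [measurable]: "\<And>n. q n \<in> borel_measurable borel" "\<And>n. f1 n \<in> borel_measurable borel"
      "\<And>n. f2 n \<in> borel_measurable borel"
      "g1 \<in> borel_measurable borel" "g2 \<in> borel_measurable borel"
    and q: "\<And>n y. \<bar>q n y\<bar> \<le> \<bar>y\<bar> + 1" "\<And>y. (\<lambda>n. q n y) \<longlonglongrightarrow> y"
    and f: "\<And>n y. \<bar>f1 n y\<bar> \<le> B" "\<And>n y. \<bar>f2 n y\<bar> \<le> B"
    and lim: "AE y in std_gaussian. (\<lambda>n. f1 n y) \<longlonglongrightarrow> g1 y \<and> (\<lambda>n. f2 n y) \<longlonglongrightarrow> g2 y"
  shows "(\<lambda>n. \<integral>\<^sup>+ w. ennreal (c_tilde lam (q n (fst w)) (q n (snd w)) (f1 n (fst w)) (f2 n (snd w)))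
     \<partial>(std_gaussian \<Otimes>\<^sub>M std_gaussian)) \<longlonglongrightarrow> independent_cost lam g1 g2"
  unfolding independent_cost_def
proof (rule nn_integral_dominated_convergence[where w = "\<lambda>w. ennreal (dominating_cost lam B w)"])
  show "AE w in std_gaussian \<Otimes>\<^sub>M std_gaussian. ennreal (c_tilde lam (q n (fst w)) (q n (snd w)) (f1 n (fst w)) (f2 n (snd w)))
      \<le> ennreal (dominating_cost lam B w)" for n
    using c_tilde_le_dominating_cost[OF assms(1,2) f(1) f(2) q(1) q(1)]
    by (intro AE_I2 ennreal_leI) (metis prod.collapse)
  show "AE w in std_gaussian \<Otimes>\<^sub>M std_gaussian.
      (\<lambda>n. ennreal (c_tilde lam (q n (fst w)) (q n (snd w)) (f1 n (fst w)) (f2 n (snd w))))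
      \<longlonglongrightarrow> ennreal (c_tilde lam (fst w) (snd w) (g1 (fst w)) (g2 (snd w)))"
    using AE_fst_snd_std_gaussian[OF lim]
    by eventually_elim (intro tendsto_ennrealI tendsto_c_tilde q, auto)
qed (use nn_integral_dominating_cost_finite[OF \<open>lam \<ge> 0\<close>] in auto)

text \<open>The actions are held fixed and only the observations are quantized; this is later
  applied to each of finitely many action pairs.\<close>

lemma quantized_cost_error_tendsto_0:
  assumes "lam \<ge> 0"
    and [measurable]: "\<And>n. q n \<in> borel_measurable borel"
    and q: "\<And>n y. \<bar>q n y\<bar> \<le> \<bar>y\<bar> + 1" "\<And>y. (\<lambda>n. q n y) \<longlonglongrightarrow> y"
  shows "(\<lambda>n. \<integral>\<^sup>+ w. ennreal \<bar>c_tilde lam (fst w) (snd w) u1 u2 - c_tilde lam (q n (fst w)) (q n (snd w)) u1 u2\<bar>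
     \<partial>(std_gaussian \<Otimes>\<^sub>M std_gaussian)) \<longlonglongrightarrow> 0"
proof -
  define B where "B = max \<bar>u1\<bar> \<bar>u2\<bar>"
  have B: "B \<ge> 0" "\<bar>u1\<bar> \<le> B" "\<bar>u2\<bar> \<le> B" by (auto simp: B_def)
  show ?thesis
    unfolding real_norm_def[symmetric]
  proof (rule nn_integral_dominated_convergence_norm[where w = "dominating_cost lam B"])
    show "AE w in std_gaussian \<Otimes>\<^sub>M std_gaussian. norm (c_tilde lam (q n (fst w)) (q n (snd w)) u1 u2)
        \<le> dominating_cost lam B w" for n
      using c_tilde_le_dominating_cost[OF assms(1) B q(1) q(1)] c_tilde_nonneg[OF assms(1)]
      by (intro AE_I2) (metis prod.collapse real_norm_def abs_of_nonneg)
    show "AE w in std_gaussian \<Otimes>\<^sub>M std_gaussian. (\<lambda>n. c_tilde lam (q n (fst w)) (q n (snd w)) u1 u2)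
        \<longlonglongrightarrow> c_tilde lam (fst w) (snd w) u1 u2"
      by (intro AE_I2 tendsto_c_tilde q tendsto_const)
  qed (use nn_integral_dominating_cost_finite[OF \<open>lam \<ge> 0\<close>] in auto)
qed

section \<open>Uniform quantizers\<close>

text \<open>Both bounds are closed because the last cell also contains its right end point.\<close>

lemma cell_bounds:
  assumes "a > 0" "i < r" "y \<in> cell a r i"
  shows "- a + 2 * a * real i / real r \<le> y" "y \<le> - a + 2 * a * real (i + 1) / real r"
proof -
  have "2 * a * real i / real r \<le> 2 * a" "r = i + 1 \<Longrightarrow> 2 * a * real (i + 1) / real r = 2 * a"
    using assms by (auto simp: divide_le_eq)
  then show "- a + 2 * a * real i / real r \<le> y" "y \<le> - a + 2 * a * real (i + 1) / real r"
    using assms(3) by (auto simp: cell_def split: if_splits)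
qed

lemma cell_unique:
  assumes "a > 0" "i < r" "j < r" "y \<in> cell a r i" "y \<in> cell a r j"
  shows "i = j"
proof -
  have False if "i < j" "j < r" "y \<in> cell a r i" "y \<in> cell a r j" for i j
  proof -
    \<comment> \<open>By \<open>i < j\<close> and \<open>j < r\<close>, cell \<open>i\<close> is not
      the last one, so its right end is excluded.\<close>
    have "y < - a + 2 * a * real (i + 1) / real r"
      using that by (auto simp: cell_def split: if_splits)
    also have "\<dots> \<le> - a + 2 * a * real j / real r"
      using that \<open>a > 0\<close> by (intro add_left_mono divide_right_mono mult_left_mono) auto
    also have "\<dots> \<le> y"
      using cell_bounds(1)[of a j r y] that \<open>a > 0\<close> by simp
    finally show False by simp
  qed
  then show ?thesis using assms by (metis linorder_neqE_nat)
qed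

lemma quantizer_eq_level:
  assumes "a > 0" "i < r" "y \<in> cell a r i"
  shows "quantizer a r y = level a r i"
proof -
  have "level a r j * indicator (cell a r j) y = (if j = i then level a r i else 0)" if "j < r" for j
    using cell_unique[of a i r j y] assms that by (cases "j = i") (auto simp: indicator_def)
  then have "quantizer a r y = (\<Sum>j<r. if j = i then level a r i else 0)"
    unfolding quantizer_def by (intro sum.cong) auto
  then show ?thesis using assms by simp
qed

lemma quantizer_outside:
  assumes "a > 0" "r \<ge> 1" "y \<notin> {- a..a}"
  shows "quantizer a r y = 0"
  unfolding quantizer_def using cells_cover[OF assms(1,2)] assms(3)
  by (intro sum.neutral ballI) (auto simp: indicator_def simp del: atLeastAtMost_iff)

lemma quantizer_inside:
  assumes "a > 0" "r \<ge> 1" "y \<in> {- a..a}"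
  shows "quantizer a r y \<in> act_levels a r" "\<bar>quantizer a r y - y\<bar> \<le> a / real r"
proof -
  obtain i where i: "i < r" "y \<in> cell a r i"
    using cells_cover[OF assms(1,2)] assms(3) by blast
  have q: "quantizer a r y = level a r i" by (rule quantizer_eq_level) (use assms i in auto)
  show "quantizer a r y \<in> act_levels a r"
    using q i by (simp add: act_levels_def)
  \<comment> \<open>A cell lies within half a cell width, \<open>a / real r\<close>, of its
    midpoint.\<close>
  have "- a + 2 * a * real i / real r = level a r i - a / real r"
       "- a + 2 * a * real (i + 1) / real r = level a r i + a / real r"
    by (simp_all add: level_def add_divide_distrib distrib_left)
  then have "level a r i - a / real r \<le> y" "y \<le> level a r i + a / real r"
    using cell_bounds[OF assms(1) i] by simp_all
  then show "\<bar>quantizer a r y - y\<bar> \<le> a / real r"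
    unfolding q by (simp add: abs_le_iff)
qed

lemma quantizer_in_meas_levels:
  assumes "a > 0" "r \<ge> 1"
  shows "quantizer a r y \<in> meas_levels a r"
  using quantizer_inside(1)[OF assms, of y] quantizer_outside[OF assms, of y]
  by (cases "y \<in> {- a..a}") (auto simp: meas_levels_def act_levels_def)

lemma measurable_quantizer [measurable (raw)]:
  assumes [measurable]: "f \<in> borel_measurable M"
  shows "(\<lambda>x. quantizer a r (f x)) \<in> borel_measurable M"
proof -
  have "cell a r i \<in> sets borel" for i
    unfolding cell_def by auto
  then show ?thesis
    unfolding quantizer_def by measurable
qed

lemma finite_meas_levels [simp]: "finite (meas_levels l n)"
  and finite_act_levels [simp]: "finite (act_levels m k)"
  by (simp_all add: meas_levels_def act_levels_def)

text \<open>The grid of index \<open>N\<close>: cells of width \<open>1 / 2^N\<close> on \<open>[-(N + 1), N + 1]\<close>.\<close>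

definition grid_bound :: "nat \<Rightarrow> real" where
  "grid_bound N = real (Suc N)"

definition grid_size :: "nat \<Rightarrow> nat" where
  "grid_size N = 2 * Suc N * 2 ^ N"

lemma grid_bound_pos: "grid_bound N > 0"
  by (simp add: grid_bound_def)

lemma grid_size_pos: "grid_size N \<ge> 1"
proof -
  have "0 < grid_size N" by (simp add: grid_size_def del: mult_Suc_right)
  then show ?thesis by simp
qed

lemma real_grid_size: "real (grid_size N) = 2 * grid_bound N * 2 ^ N"
  by (simp add: grid_bound_def grid_size_def algebra_simps)

lemma grid_half_width: "grid_bound N / real (grid_size N) = (1 / 2) ^ Suc N"
  using grid_bound_pos[of N] unfolding real_grid_size by (simp add: power_divide)

abbreviation grid_quantizer :: "nat \<Rightarrow> real \<Rightarrow> real" where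
  "grid_quantizer N \<equiv> quantizer (grid_bound N) (grid_size N)"

text \<open>This bound, uniform in \<open>N\<close>, is what domination requires: inside the range
  the error is at most half a cell width, outside it the value is 0.\<close>

lemma abs_grid_quantizer_le: "\<bar>grid_quantizer N y\<bar> \<le> \<bar>y\<bar> + 1"
proof (cases "y \<in> {- grid_bound N..grid_bound N}")
  case True
  have "(1 / 2) ^ Suc N \<le> (1 :: real)" by (rule power_le_one) auto
  then show ?thesis
    using quantizer_inside(2)[OF grid_bound_pos[of N] grid_size_pos[of N] True]
    unfolding grid_half_width by linarith
next
  case False
  then show ?thesis by (simp add: quantizer_outside[OF grid_bound_pos grid_size_pos])
qed

lemma grid_quantizer_error_bound:
  assumes "\<bar>y\<bar> \<le> real N"
  shows "\<bar>grid_quantizer N y - y\<bar> \<le> (1 / 2) ^ Suc N"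
proof -
  have "y \<in> {- grid_bound N..grid_bound N}"
    using assms by (simp add: grid_bound_def abs_le_iff)
  from quantizer_inside(2)[OF grid_bound_pos[of N] grid_size_pos[of N] this] show ?thesis
    unfolding grid_half_width .
qed

text \<open>The error tends to 0 uniformly on bounded sets, so the quantized point may itself move
  with \<open>j\<close>, as it does when an action computed from a quantized observation is
  quantized in turn.\<close>

lemma grid_quantizer_tendsto:
  assumes "filterlim N at_top sequentially" "f \<longlonglongrightarrow> y"
  shows "(\<lambda>j. grid_quantizer (N j) (f j)) \<longlonglongrightarrow> y"
proof -
  obtain B where B: "\<And>j. \<bar>f j\<bar> \<le> B"
    using convergent_imp_Bseq[of f] assms(2) by (auto simp: convergent_def Bseq_def)
  have "(\<lambda>j. (1 / 2) ^ Suc (N j) :: real) \<longlonglongrightarrow> 0"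
    by (rule filterlim_compose[OF _ assms(1)], rule LIMSEQ_Suc, rule LIMSEQ_realpow_zero) auto
  moreover have "\<forall>\<^sub>F j in sequentially. norm (grid_quantizer (N j) (f j) - f j) \<le> (1 / 2) ^ Suc (N j)"
  proof -
    have "\<forall>\<^sub>F j in sequentially. nat \<lceil>B\<rceil> \<le> N j"
      using assms(1) unfolding filterlim_at_top by blast
    then show ?thesis
    proof eventually_elim
      case (elim j)
      then have "\<bar>f j\<bar> \<le> real (N j)" using B[of j] by linarith
      then show ?case by (metis grid_quantizer_error_bound real_norm_def)
    qed
  qed
  ultimately have "(\<lambda>j. grid_quantizer (N j) (f j) - f j) \<longlonglongrightarrow> 0"
    by (rule Lim_null_comparison[rotated])
  from tendsto_add[OF this assms(2)] show ?thesis by simp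
qed

section \<open>Nesting of the dyadic partitions\<close>

lemma in_grid_cell_iff:
  assumes "y \<noteq> grid_bound N"
  shows "y \<in> cell (grid_bound N) (grid_size N) i \<longleftrightarrow>
    of_int (int i - int (Suc N) * 2 ^ N) \<le> y * 2 ^ N \<and>
    y * 2 ^ N < of_int (int i - int (Suc N) * 2 ^ N) + 1"
proof -
  \<comment> \<open>In units of \<open>1 / 2^N\<close>, cell \<open>i\<close> is the interval [X, X
    + 1) with the integer X = i - (N + 1) 2^N; the closed end point of the last cell is the excluded
    value of \<open>y\<close>.\<close>
  have "2 * grid_bound N * x / real (grid_size N) = x / 2 ^ N" for x
    using grid_bound_pos[of N] unfolding real_grid_size by simp
  then have "y \<in> cell (grid_bound N) (grid_size N) i \<longleftrightarrow>
      - grid_bound N + real i / 2 ^ N \<le> y \<and> y < - grid_bound N + real (i + 1) / 2 ^ N"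
    using assms unfolding cell_def by auto
  also have "\<dots> \<longleftrightarrow> real i - grid_bound N * 2 ^ N \<le> y * 2 ^ N \<and> y * 2 ^ N < real i - grid_bound N * 2 ^ N + 1"
    by (auto simp: field_simps)
  finally show ?thesis by (simp add: grid_bound_def)
qed

text \<open>The ranges end at integers, so the cells of each grid are dyadic intervals, and those of
  different scales are nested. A fine cell therefore lies, except perhaps for right end points of
  the ranges, in one coarse cell or outside the coarse range.\<close>

lemma refines_grid_partition:
  assumes "N \<le> N'"
  shows "refines_upto_boundary (quantizer_partition (grid_bound N') (grid_size N'))
    (quantizer_partition (grid_bound N) (grid_size N))" (is "refines_upto_boundary ?P ?Q")
proof -
  let ?a = "grid_bound N" and ?a' = "grid_bound N'"
  \<comment> \<open>The ends of a range belong to the frontier of its outer cell, which admits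
    \<open>?a\<close> and \<open>?a'\<close> as exceptional points.\<close>
  have frontier: "frontier (- {- a..a}) = {- a, a}" if "a > 0" for a :: real
    using that by (subst frontier_complement) (auto simp: frontier_def)
  have aa': "{?a, ?a'} \<subseteq> (\<Union>E\<in>?P \<union> ?Q. frontier E)"
    using frontier[OF grid_bound_pos[of N]] frontier[OF grid_bound_pos[of N']]
    by (auto simp: quantizer_partition_def)
  have "\<exists>D\<in>?Q. C - D \<subseteq> {?a, ?a'}" if C: "C \<in> ?P" for C
  proof (cases "C = - {- ?a'..?a'}")
    case True
    moreover have "- {- ?a'..?a'} \<subseteq> - {- ?a..?a}"
      using assms by (auto simp: grid_bound_def)
    ultimately show ?thesis by (auto simp: quantizer_partition_def)
  next
    case False
    then obtain i where i: "C = cell ?a' (grid_size N') i"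
      using C by (auto simp: quantizer_partition_def)
    define d :: nat where "d = 2 ^ (N' - N)"
    have d: "d > 0" "(2 :: real) ^ N' = 2 ^ N * real d"
      using assms by (simp_all add: d_def power_add[symmetric])
    \<comment> \<open>\<open>X\<close> is the left end of the fine cell in units of
      \<open>1 / 2^N'\<close>; \<open>e\<close> is the left end, in units of \<open>1 / 2^N\<close>,
      of the coarse dyadic interval around that cell.\<close>
    define X where "X = int i - int (Suc N') * 2 ^ N'"
    define e where "e = X div int d"
    \<comment> \<open>The second inequality is \<open>X < (e + 1) * int d\<close> sharpened by
      integrality.\<close>
    have e: "e * int d \<le> X" "X + 1 \<le> (e + 1) * int d"
      using d(1) div_mult_mod_eq[of X "int d"] pos_mod_sign[of "int d" X] pos_mod_bound[of "int d" X]
      unfolding e_def distrib_right by linarith+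
    have y: "of_int e \<le> y * 2 ^ N \<and> y * 2 ^ N < of_int e + 1" if "y \<in> C" "y \<noteq> ?a'" for y
    proof -
      have "of_int X \<le> y * 2 ^ N'" "y * 2 ^ N' < of_int X + 1"
        using that unfolding i X_def in_grid_cell_iff[OF that(2)] by auto
      moreover have "real_of_int (e * int d) \<le> of_int X" "real_of_int (X + 1) \<le> of_int ((e + 1) * int d)"
        using e by (simp_all only: of_int_le_iff)
      ultimately have "of_int e * real d \<le> (y * 2 ^ N) * real d" "(y * 2 ^ N) * real d < (of_int e + 1) * real d"
        unfolding d(2) by (simp_all add: mult.assoc)
      then show ?thesis using d(1) by simp
    qed
    define A where "A = int (Suc N) * 2 ^ N"
    have A: "real_of_int A = ?a * 2 ^ N" by (simp add: A_def grid_bound_def)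
    \<comment> \<open>The coarse dyadic interval lies to the right of the coarse range, to its left,
      or is one of its cells. On the right the closed end point \<open>?a\<close> may be left
      over.\<close>
    consider "A \<le> e" | "e + 1 \<le> - A" | "- A \<le> e" "e < A" by linarith
    then show ?thesis
    proof cases
      case 1
      have "?a \<le> y" if "y \<in> C" "y \<noteq> ?a'" for y
      proof -
        have "?a * 2 ^ N \<le> of_int e" using 1 by (simp only: A[symmetric] of_int_le_iff)
        also have "\<dots> \<le> y * 2 ^ N" using y[OF that] by simp
        finally show ?thesis by simp
      qed
      then have "C - - {- ?a..?a} \<subseteq> {?a, ?a'}" by force
      then show ?thesis by (auto simp: quantizer_partition_def)
    next
      case 2
      have "y < - ?a" if "y \<in> C" "y \<noteq> ?a'" for y
      proof -
        have "y * 2 ^ N < of_int (e + 1)" using y[OF that] by simp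
        also have "\<dots> \<le> of_int (- A)" using 2 by (simp only: of_int_le_iff)
        also have "\<dots> = (- ?a) * 2 ^ N" using A by simp
        finally show ?thesis by (subst (asm) mult_less_cancel_right_pos) simp_all
      qed
      then have "C - - {- ?a..?a} \<subseteq> {?a, ?a'}" by force
      then show ?thesis by (auto simp: quantizer_partition_def)
    next
      case 3
      define i' where "i' = nat (e + A)"
      have i': "int i' - int (Suc N) * 2 ^ N = e" using 3 unfolding A_def[symmetric] by (simp add: i'_def)
      have "int (grid_size N) = 2 * A" by (simp add: A_def grid_size_def algebra_simps)
      then have "i' < grid_size N" using 3 by (simp add: i'_def)
      then have "cell ?a (grid_size N) i' \<in> ?Q"
        by (auto simp: quantizer_partition_def)
      moreover have "C - cell ?a (grid_size N) i' \<subseteq> {?a, ?a'}"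
        using y in_grid_cell_iff[of _ N i'] unfolding i' by blast
      ultimately show ?thesis by blast
    qed
  qed
  then show ?thesis
    unfolding refines_upto_boundary_def using aa' by (meson order_trans)
qed

section \<open>The cost of a finite model\<close>

lemma measure_quantized_gaussian:
  "ennreal (measure (quantized_gaussian l n) {z}) = emeasure std_gaussian (quantizer l n -` {z})"
  unfolding quantized_gaussian_def by (subst measure_distr) (auto simp: gauss.emeasure_eq_measure)

text \<open>The integrand is constant on products of preimages of levels, whose product measure is
  the product of the masses. Indexing by points rather than by cells makes a coincidence of 0 with a
  level harmless.\<close>

lemma ennreal_finite_cost:
  assumes "lam \<ge> 0" "l > 0" "n \<ge> 1"
  shows "ennreal (finite_cost lam l n p1 p2) =
    (\<integral>\<^sup>+ w. ennreal (c_tilde lam (quantizer l n (fst w)) (quantizer l n (snd w))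
        (p1 (quantizer l n (fst w))) (p2 (quantizer l n (snd w)))) \<partial>(std_gaussian \<Otimes>\<^sub>M std_gaussian))"
proof -
  let ?q = "quantizer l n" and ?Z = "meas_levels l n"
  define f where "f z z' = ennreal (c_tilde lam z z' (p1 z) (p2 z'))" for z z'
  have [measurable]: "?q -` {z} \<in> sets borel" for z
    using measurable_sets[OF measurable_quantizer[OF measurable_ident_sets[OF refl, of borel]], of "{z}" l n] by simp
  \<comment> \<open>Exactly one pair of levels has nonzero indicators.\<close>
  have "f (?q x) (?q y) = (\<Sum>z\<in>?Z. \<Sum>z'\<in>?Z. f z z' * (indicator (?q -` {z}) x * indicator (?q -` {z'}) y))" for x y
  proof -
    have "(\<Sum>z\<in>?Z. \<Sum>z'\<in>?Z. f z z' * (indicator (?q -` {z}) x * indicator (?q -` {z'}) y)) =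
        (\<Sum>z\<in>?Z. if z = ?q x then (\<Sum>z'\<in>?Z. if z' = ?q y then f z z' else 0) else 0)"
      by (intro sum.cong refl) (auto simp: indicator_def intro!: sum.cong)
    then show ?thesis
      using quantizer_in_meas_levels[OF assms(2,3)] by simp
  qed
  then have "(\<integral>\<^sup>+ w. f (?q (fst w)) (?q (snd w)) \<partial>(std_gaussian \<Otimes>\<^sub>M std_gaussian)) =
      (\<integral>\<^sup>+ w. (\<Sum>z\<in>?Z. \<Sum>z'\<in>?Z. f z z' * (indicator (?q -` {z}) (fst w) * indicator (?q -` {z'}) (snd w)))
        \<partial>(std_gaussian \<Otimes>\<^sub>M std_gaussian))"
    by simp
  also have "\<dots> = (\<Sum>z\<in>?Z. \<Sum>z'\<in>?Z. f z z' *
      (emeasure std_gaussian (?q -` {z}) * emeasure std_gaussian (?q -` {z'})))"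
    by (simp add: nn_integral_sum nn_integral_cmult nn_integral_pair_mult)
  also have "\<dots> = ennreal (finite_cost lam l n p1 p2)"
    unfolding finite_cost_def f_def measure_quantized_gaussian[symmetric]
    using c_tilde_nonneg[OF assms(1)]
    by (simp add: ennreal_mult sum_ennreal[symmetric] sum_nonneg mult.assoc)
  finally show ?thesis unfolding f_def by simp
qed

text \<open>\<open>p\<close> may be arbitrary: the quantizer is a simple function, and so is its
  composition with any map.\<close>

lemma measurable_comp_quantizer:
  assumes "l > 0" "n \<ge> 1"
  shows "(\<lambda>y. p (quantizer l n y)) \<in> borel_measurable borel"
proof -
  have "range (quantizer l n) \<subseteq> meas_levels l n"
    using quantizer_in_meas_levels[OF assms] by blast
  then have "finite (quantizer l n ` space borel)"
    by (simp add: finite_subset)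
  moreover have "quantizer l n \<in> borel_measurable borel"
    using measurable_quantizer[of "\<lambda>y. y" borel l n] by simp
  ultimately have "simple_function borel (quantizer l n)"
    by (rule simple_function_borel_measurable[rotated])
  from borel_measurable_simple_function[OF simple_function_compose[OF this, of p]]
  show ?thesis by (simp add: o_def)
qed

definition quantized_cost_error :: "real \<Rightarrow> nat \<Rightarrow> real \<Rightarrow> real \<Rightarrow> ennreal" where
  "quantized_cost_error lam N u1 u2 =
     (\<integral>\<^sup>+ w. ennreal \<bar>c_tilde lam (fst w) (snd w) u1 u2 -
        c_tilde lam (grid_quantizer N (fst w)) (grid_quantizer N (snd w)) u1 u2\<bar> \<partial>(std_gaussian \<Otimes>\<^sub>M std_gaussian))"

text \<open>At each point the policies choose some pair of actions, so the error there is at most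
  the sum of the errors over all pairs. The resulting bound does not depend on the policies, whose
  domain grows with \<open>N\<close>.\<close>

lemma independent_cost_le_finite_cost:
  assumes "lam \<ge> 0" and p: "(p1, p2) \<in> policies (grid_bound N) (grid_size N) m k"
  shows "independent_cost lam (\<lambda>y. p1 (grid_quantizer N y)) (\<lambda>y. p2 (grid_quantizer N y)) \<le>
    ennreal (finite_cost lam (grid_bound N) (grid_size N) p1 p2) +
    (\<Sum>u1\<in>act_levels m k. \<Sum>u2\<in>act_levels m k. quantized_cost_error lam N u1 u2)"
proof -
  let ?q = "grid_quantizer N" and ?U = "act_levels m k" and ?G = "std_gaussian \<Otimes>\<^sub>M std_gaussian"
  define e where "e w u1 u2 = ennreal \<bar>c_tilde lam (fst w) (snd w) u1 u2 - c_tilde lam (?q (fst w)) (?q (snd w)) u1 u2\<bar>"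
    for w u1 u2
  have [measurable]: "(\<lambda>y. p1 (?q y)) \<in> borel_measurable borel" "(\<lambda>y. p2 (?q y)) \<in> borel_measurable borel"
    by (rule measurable_comp_quantizer[OF grid_bound_pos grid_size_pos])+
  have U: "p1 (?q y) \<in> ?U" "p2 (?q y) \<in> ?U" for y
  proof -
    have "p1 \<in> meas_levels (grid_bound N) (grid_size N) \<rightarrow>\<^sub>E ?U"
      "p2 \<in> meas_levels (grid_bound N) (grid_size N) \<rightarrow>\<^sub>E ?U"
      using p unfolding policies_def by blast+
    then show "p1 (?q y) \<in> ?U" "p2 (?q y) \<in> ?U"
      using quantizer_in_meas_levels[OF grid_bound_pos[of N] grid_size_pos[of N]] by (blast dest: PiE_mem)+
  qed
  have "independent_cost lam (\<lambda>y. p1 (?q y)) (\<lambda>y. p2 (?q y)) \<le>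
    (\<integral>\<^sup>+ w. ennreal (c_tilde lam (?q (fst w)) (?q (snd w)) (p1 (?q (fst w))) (p2 (?q (snd w)))) +
      (\<Sum>u1\<in>?U. \<Sum>u2\<in>?U. e w u1 u2) \<partial>?G)"
    unfolding independent_cost_def
  proof (rule nn_integral_mono)
    fix w
    let ?u1 = "p1 (?q (fst w))" and ?u2 = "p2 (?q (snd w))"
    have "ennreal (c_tilde lam (fst w) (snd w) ?u1 ?u2) \<le>
        ennreal (c_tilde lam (?q (fst w)) (?q (snd w)) ?u1 ?u2) + e w ?u1 ?u2"
      unfolding e_def using c_tilde_nonneg[OF \<open>lam \<ge> 0\<close>]
      by (simp add: ennreal_plus[symmetric] ennreal_leI del: ennreal_plus)
    also have "e w ?u1 ?u2 \<le> (\<Sum>u2\<in>?U. e w ?u1 u2)"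
      by (rule member_le_sum) (use U in auto)
    also have "\<dots> \<le> (\<Sum>u1\<in>?U. \<Sum>u2\<in>?U. e w u1 u2)"
      by (rule member_le_sum[of ?u1 ?U "\<lambda>u1. \<Sum>u2\<in>?U. e w u1 u2"]) (use U in auto)
    finally show "ennreal (c_tilde lam (fst w) (snd w) ?u1 ?u2) \<le>
        ennreal (c_tilde lam (?q (fst w)) (?q (snd w)) ?u1 ?u2) + (\<Sum>u1\<in>?U. \<Sum>u2\<in>?U. e w u1 u2)"
      by (simp add: add_left_mono)
  qed
  also have "\<dots> = ennreal (finite_cost lam (grid_bound N) (grid_size N) p1 p2) +
      (\<Sum>u1\<in>?U. \<Sum>u2\<in>?U. quantized_cost_error lam N u1 u2)"
    unfolding e_def quantized_cost_error_def
    by (subst nn_integral_add) (auto simp: ennreal_finite_cost[OF \<open>lam \<ge> 0\<close> grid_bound_pos grid_size_pos] nn_integral_sum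
        simp del: sum_ennreal)
  finally show ?thesis .
qed

lemma eventually_sum_quantized_cost_error_le:
  assumes "lam \<ge> 0" "\<epsilon> > 0"
  shows "\<exists>K. \<forall>N\<ge>K. (\<Sum>u1\<in>act_levels m k. \<Sum>u2\<in>act_levels m k. quantized_cost_error lam N u1 u2) \<le> ennreal \<epsilon>"
proof -
  have "(\<lambda>N. quantized_cost_error lam N u1 u2) \<longlonglongrightarrow> 0" for u1 u2
    unfolding quantized_cost_error_def
    by (rule quantized_cost_error_tendsto_0[OF assms(1)])
      (auto intro: abs_grid_quantizer_le grid_quantizer_tendsto filterlim_ident)
  then have "(\<lambda>N. \<Sum>u1\<in>act_levels m k. \<Sum>u2\<in>act_levels m k. quantized_cost_error lam N u1 u2) \<longlonglongrightarrow> 0"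
    by (intro tendsto_null_sum) auto
  from order_tendstoD(2)[OF this, of "ennreal \<epsilon>"] show ?thesis
    using assms(2) by (auto simp: eventually_sequentially intro: less_imp_le)
qed

section \<open>Reduction to bounded continuous policies\<close>

text \<open>Off a Lebesgue null set a measurable function is a pointwise limit of continuous ones,
  and the Gaussian law has a density, so the set stays null. Clipping to \<open>[-B, B]\<close>
  keeps continuity and leaves \<open>g\<close> fixed.\<close>

lemma bounded_continuous_approximation:
  assumes [measurable]: "g \<in> borel_measurable borel" and "\<And>y. \<bar>g y\<bar> \<le> B"
  obtains h :: "nat \<Rightarrow> real \<Rightarrow> real" where "\<And>n. continuous_on UNIV (h n)" "\<And>n y. \<bar>h n y\<bar> \<le> B"
    "AE y in std_gaussian. (\<lambda>n. h n y) \<longlonglongrightarrow> g y"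
proof -
  have "g measurable_on UNIV"
    by (rule lebesgue_measurable_imp_measurable_on_real) (simp_all add: measurable_completion)
  then obtain N h where N: "negligible N" and h: "\<And>n. continuous_on UNIV (h n)"
    and lim: "\<And>x. x \<notin> N \<Longrightarrow> (\<lambda>n. h n x) \<longlonglongrightarrow> g x"
    by (auto simp: measurable_on_def)
  have B: "B \<ge> 0" using assms(2)[of 0] by simp
  have clip: "max (- B) (min B (g y)) = g y" for y
    using assms(2)[of y] by (simp add: abs_le_iff)
  have "AE y in lebesgue. y \<notin> N"
    using N by (intro AE_not_in) (simp add: negligible_iff_null_sets)
  then have "AE y in lborel. y \<notin> N"
    by (simp add: AE_completion_iff)
  then have "AE y in std_gaussian. y \<notin> N"
    unfolding std_gaussian_def by (subst AE_density) auto
  then have "AE y in std_gaussian. (\<lambda>n. max (- B) (min B (h n y))) \<longlonglongrightarrow> g y"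
  proof eventually_elim
    case (elim y)
    have "(\<lambda>n. max (- B) (min B (h n y))) \<longlonglongrightarrow> max (- B) (min B (g y))"
      by (intro tendsto_intros lim elim)
    then show ?case by (simp add: clip)
  qed
  then show thesis
    using B by (intro that[of "\<lambda>n y. max (- B) (min B (h n y))"]) (auto intro!: continuous_intros h)
qed

text \<open>\<open>L\<close> will be the limit superior of the finite optimal costs. A lower bound
  on costs survives limits of costs, so the class of policies it applies to can be enlarged step by
  step.\<close>

lemma le_independent_cost_if_bounded:
  assumes "lam \<ge> 0"
    and L: "\<And>g1 g2 B. continuous_on UNIV g1 \<Longrightarrow> continuous_on UNIV g2 \<Longrightarrow>
      (\<And>y. \<bar>g1 y\<bar> \<le> B) \<Longrightarrow> (\<And>y. \<bar>g2 y\<bar> \<le> B) \<Longrightarrow> L \<le> independent_cost lam g1 g2"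
    and [measurable]: "g1 \<in> borel_measurable borel" "g2 \<in> borel_measurable borel"
    and B: "\<And>y. \<bar>g1 y\<bar> \<le> B" "\<And>y. \<bar>g2 y\<bar> \<le> B"
  shows "L \<le> independent_cost lam g1 g2"
proof -
  obtain h1 where h1: "\<And>n. continuous_on UNIV (h1 n)" "\<And>n y. \<bar>h1 n y\<bar> \<le> B"
    "AE y in std_gaussian. (\<lambda>n. h1 n y) \<longlonglongrightarrow> g1 y"
    using bounded_continuous_approximation[OF assms(3) B(1)] by metis
  obtain h2 where h2: "\<And>n. continuous_on UNIV (h2 n)" "\<And>n y. \<bar>h2 n y\<bar> \<le> B"
    "AE y in std_gaussian. (\<lambda>n. h2 n y) \<longlonglongrightarrow> g2 y"
    using bounded_continuous_approximation[OF assms(4) B(2)] by metis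
  have [measurable]: "h1 n \<in> borel_measurable borel" "h2 n \<in> borel_measurable borel" for n
    using h1(1) h2(1) by (auto intro: borel_measurable_continuous_onI)
  have "B \<ge> 0" using B(1)[of 0] by simp
  have "(\<lambda>n. independent_cost lam (h1 n) (h2 n)) \<longlonglongrightarrow> independent_cost lam g1 g2"
    unfolding independent_cost_def[of lam "h1 _"]
    by (rule bounded_cost_tendsto[OF assms(1) \<open>B \<ge> 0\<close>, where q = "\<lambda>_ y. y"])
      (use h1 h2 in auto)
  then show ?thesis
    by (rule LIMSEQ_le_const) (use L h1 h2 in blast)
qed

section \<open>Removing the bounds on the policies\<close>

definition cut_off :: "nat \<Rightarrow> real \<Rightarrow> real" where
  "cut_off n x = (if \<bar>x\<bar> \<le> real n then x else 0)"

lemma measurable_cut_off [measurable (raw)]: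
  assumes [measurable]: "f \<in> borel_measurable M"
  shows "(\<lambda>x. cut_off n (f x)) \<in> borel_measurable M"
  unfolding cut_off_def by measurable

lemma abs_cut_off_le: "\<bar>cut_off n x\<bar> \<le> real n"
  by (simp add: cut_off_def)

lemma eventually_cut_off: "\<forall>\<^sub>F n in sequentially. cut_off n x = x"
proof -
  have "\<forall>\<^sub>F n in sequentially. nat \<lceil>\<bar>x\<bar>\<rceil> \<le> n" by (rule eventually_ge_at_top)
  then show ?thesis
  proof eventually_elim
    case (elim n)
    then have "\<bar>x\<bar> \<le> real n" by linarith
    then show ?case by (simp add: cut_off_def)
  qed
qed

lemma tendsto_cut_off: "(\<lambda>n. cut_off n x) \<longlonglongrightarrow> x"
  by (rule tendsto_eventually[OF eventually_cut_off])

text \<open>Cutting off to \<open>0\<close> rather than clamping keeps \<open>likelihood_ratio u1 y2\<close> under control: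
  it is not monotone in \<open>u1\<close>, but equals \<open>1\<close> at \<open>u1 = 0\<close>.\<close>

lemma le_independent_cost_if_snd_bounded:
  assumes "lam > 0"
    and L: "\<And>g1 g2 B. g1 \<in> borel_measurable borel \<Longrightarrow> g2 \<in> borel_measurable borel \<Longrightarrow>
      (\<And>y. \<bar>g1 y\<bar> \<le> B) \<Longrightarrow> (\<And>y. \<bar>g2 y\<bar> \<le> B) \<Longrightarrow> L \<le> independent_cost lam g1 g2"
    and [measurable]: "g1 \<in> borel_measurable borel" "g2 \<in> borel_measurable borel"
    and B: "\<And>y. \<bar>g2 y\<bar> \<le> B"
  shows "L \<le> independent_cost lam g1 g2"
\<comment> \<open>Infinite cost makes the bound trivial; finite cost is used because the cost itself
  is part of the majorant.\<close>
proof (cases "independent_cost lam g1 g2 < \<infinity>")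
  case True
  have "B \<ge> 0" using B[of 0] by simp
  have "(\<lambda>n. independent_cost lam (\<lambda>y. cut_off n (g1 y)) g2) \<longlonglongrightarrow> independent_cost lam g1 g2"
    unfolding independent_cost_def
  proof (rule nn_integral_dominated_convergence[where w =
        "\<lambda>w. ennreal (c_tilde lam (fst w) (snd w) (g1 (fst w)) (g2 (snd w))) + ennreal (dominating_cost lam B w)"])
    show "AE w in std_gaussian \<Otimes>\<^sub>M std_gaussian.
        ennreal (c_tilde lam (fst w) (snd w) (cut_off n (g1 (fst w))) (g2 (snd w))) \<le>
        ennreal (c_tilde lam (fst w) (snd w) (g1 (fst w)) (g2 (snd w))) + ennreal (dominating_cost lam B w)" for n
    proof (rule AE_I2)
      fix w
      \<comment> \<open>The cut-off action is that of \<open>g1\<close> or 0; the first summand of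
        the majorant covers the former case, \<open>dominating_cost\<close> the latter.\<close>
      have "c_tilde lam (fst w) (snd w) 0 (g2 (snd w)) \<le> dominating_cost lam B (fst w, snd w)"
        using \<open>lam > 0\<close> \<open>B \<ge> 0\<close> B by (intro c_tilde_le_dominating_cost) auto
      then show "ennreal (c_tilde lam (fst w) (snd w) (cut_off n (g1 (fst w))) (g2 (snd w))) \<le>
        ennreal (c_tilde lam (fst w) (snd w) (g1 (fst w)) (g2 (snd w))) + ennreal (dominating_cost lam B w)"
        by (auto simp: cut_off_def intro: add_increasing add_increasing2 ennreal_leI)
    qed
    show "(\<integral>\<^sup>+ w. ennreal (c_tilde lam (fst w) (snd w) (g1 (fst w)) (g2 (snd w))) + ennreal (dominating_cost lam B w)
        \<partial>(std_gaussian \<Otimes>\<^sub>M std_gaussian)) < \<infinity>"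
      using True nn_integral_dominating_cost_finite[of lam B] \<open>lam > 0\<close>
      by (subst nn_integral_add) (auto simp: independent_cost_def)
    show "AE w in std_gaussian \<Otimes>\<^sub>M std_gaussian.
        (\<lambda>n. ennreal (c_tilde lam (fst w) (snd w) (cut_off n (g1 (fst w))) (g2 (snd w))))
        \<longlonglongrightarrow> ennreal (c_tilde lam (fst w) (snd w) (g1 (fst w)) (g2 (snd w)))"
      by (intro AE_I2 tendsto_ennrealI tendsto_c_tilde tendsto_const tendsto_cut_off)
  qed auto
  moreover have "L \<le> independent_cost lam (\<lambda>y. cut_off n (g1 y)) g2" for n
    using abs_cut_off_le B
    by (intro L[where B = "max B (real n)"]) (auto simp: le_max_iff_disj)
  ultimately show ?thesis by (intro LIMSEQ_le_const) auto
qed (simp add: not_less top_unique)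

text \<open>With \<open>g1\<close> unbounded, \<open>dominating_cost\<close> is no majorant.
  Replacing the second action by 0 adds at most the square of the first action, which the first
  stage controls up to the square of its observation; the latter, weighted by the likelihood ratio,
  is integrable.\<close>

lemma le_independent_cost:
  assumes "lam > 0"
    and L: "\<And>g1 g2 B. continuous_on UNIV g1 \<Longrightarrow> continuous_on UNIV g2 \<Longrightarrow>
      (\<And>y. \<bar>g1 y\<bar> \<le> B) \<Longrightarrow> (\<And>y. \<bar>g2 y\<bar> \<le> B) \<Longrightarrow> L \<le> independent_cost lam g1 g2"
    and [measurable]: "g1 \<in> borel_measurable borel" "g2 \<in> borel_measurable borel"
  shows "L \<le> independent_cost lam g1 g2"
proof (cases "independent_cost lam g1 g2 < \<infinity>")
  case True
  let ?G = "std_gaussian \<Otimes>\<^sub>M std_gaussian"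
  let ?c = "\<lambda>w. c_tilde lam (fst w) (snd w) (g1 (fst w)) (g2 (snd w))"
  let ?d = "\<lambda>w. 2 * exp (2 * \<bar>fst w\<bar>) * likelihood_ratio (g1 (fst w)) (snd w)"
  have "(\<lambda>n. independent_cost lam g1 (\<lambda>y. cut_off n (g2 y))) \<longlonglongrightarrow> independent_cost lam g1 g2"
    unfolding independent_cost_def
  proof (rule nn_integral_dominated_convergence[where w =
        "\<lambda>w. ennreal (1 + 2 / lam) * ennreal (?c w) + ennreal (?d w)"])
    show "AE w in ?G. ennreal (c_tilde lam (fst w) (snd w) (g1 (fst w)) (cut_off n (g2 (snd w)))) \<le>
        ennreal (1 + 2 / lam) * ennreal (?c w) + ennreal (?d w)" for n
    proof (rule AE_I2)
      fix w
      let ?y = "fst w" and ?u1 = "g1 (fst w)" and ?u2 = "g2 (snd w)"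
      have "cut_off n ?u2 = ?u2 \<or> cut_off n ?u2 = 0" by (simp add: cut_off_def)
      then have "(cut_off n ?u2 - ?u1)\<^sup>2 \<le> (?u2 - ?u1)\<^sup>2 + ?u1\<^sup>2" by auto
      moreover have "?u1\<^sup>2 \<le> 2 * (?u1 - ?y)\<^sup>2 + 2 * ?y\<^sup>2"
        using zero_le_power2[of "?u1 - 2 * ?y"] by (simp add: power2_eq_square algebra_simps)
      moreover have "?y\<^sup>2 \<le> exp (2 * \<bar>?y\<bar>)"
        using square_one_plus_abs_le[of ?y] power_mono[of "\<bar>?y\<bar>" "1 + \<bar>?y\<bar>" 2] by simp
      ultimately have "stage_cost lam ?y ?u1 (cut_off n ?u2) \<le>
          stage_cost lam ?y ?u1 ?u2 + 2 * (?u1 - ?y)\<^sup>2 + 2 * exp (2 * \<bar>?y\<bar>)"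
        unfolding stage_cost_def by linarith
      \<comment> \<open>The first-stage term alone gives this, as \<open>lam > 0\<close>; hence the
        factor \<open>2 / lam\<close>.\<close>
      also have "2 * (?u1 - ?y)\<^sup>2 \<le> (2 / lam) * stage_cost lam ?y ?u1 ?u2"
        using \<open>lam > 0\<close> by (simp add: stage_cost_def field_simps)
      finally have "stage_cost lam ?y ?u1 (cut_off n ?u2) \<le>
          (1 + 2 / lam) * stage_cost lam ?y ?u1 ?u2 + 2 * exp (2 * \<bar>?y\<bar>)"
        by (simp add: distrib_right)
      then have "c_tilde lam ?y (snd w) ?u1 (cut_off n ?u2) \<le> (1 + 2 / lam) * ?c w + ?d w"
        unfolding c_tilde_def using mult_right_mono[OF _ less_imp_le[OF likelihood_ratio_pos[of ?u1 "snd w"]]]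
        by (fastforce simp: distrib_right mult.assoc)
      then show "ennreal (c_tilde lam ?y (snd w) ?u1 (cut_off n ?u2)) \<le>
          ennreal (1 + 2 / lam) * ennreal (?c w) + ennreal (?d w)"
        using \<open>lam > 0\<close> c_tilde_nonneg[of lam] likelihood_ratio_pos
        by (simp add: ennreal_mult[symmetric] ennreal_plus[symmetric] less_imp_le del: ennreal_plus)
    qed
    \<comment> \<open>The second observation is integrated first: the likelihood ratio then
      contributes 1, however large \<open>g1 y\<close> is.\<close>
    have "(\<integral>\<^sup>+ w. ennreal (?d w) \<partial>?G) =
        (\<integral>\<^sup>+ y. \<integral>\<^sup>+ y'. ennreal (2 * exp (2 * \<bar>y\<bar>)) * ennreal (likelihood_ratio (g1 y) y') \<partial>std_gaussian \<partial>std_gaussian)"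
      by (subst gauss.nn_integral_fst[symmetric]) (auto simp: ennreal_mult less_imp_le[OF likelihood_ratio_pos])
    also have "\<dots> = 2 * (\<integral>\<^sup>+ y. ennreal (exp (2 * \<bar>y\<bar>)) \<partial>std_gaussian)"
      by (simp add: nn_integral_cmult nn_integral_likelihood_ratio ennreal_mult)
    also have "\<dots> < \<infinity>"
      using nn_integral_exp_abs_finite[of 2] by (simp add: ennreal_mult_less_top)
    finally show "(\<integral>\<^sup>+ w. ennreal (1 + 2 / lam) * ennreal (?c w) + ennreal (?d w) \<partial>?G) < \<infinity>"
      using True by (subst nn_integral_add)
        (auto simp: independent_cost_def nn_integral_cmult ennreal_mult_less_top)
    show "AE w in ?G. (\<lambda>n. ennreal (c_tilde lam (fst w) (snd w) (g1 (fst w)) (cut_off n (g2 (snd w)))))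
        \<longlonglongrightarrow> ennreal (?c w)"
      by (intro AE_I2 tendsto_ennrealI tendsto_c_tilde tendsto_const tendsto_cut_off)
  qed auto
  moreover have "L \<le> independent_cost lam g1 (\<lambda>y. cut_off n (g2 y))" for n
    \<comment> \<open>Two enlargements are nested: from bounded continuous to bounded measurable
      policies, and from there to pairs in which only the second policy is bounded.\<close>
    by (rule le_independent_cost_if_snd_bounded[OF \<open>lam > 0\<close>
          le_independent_cost_if_bounded[OF less_imp_le[OF \<open>lam > 0\<close>] L], where B = "real n"])
      (auto intro: abs_cut_off_le)
  ultimately show ?thesis by (intro LIMSEQ_le_const) auto
qed (simp add: not_less top_unique)

section \<open>Convergence of the optimal costs\<close>

text \<open>Policies are extensional maps between finite sets, hence finite in number, and
  \<open>k \<ge> 1\<close> makes some exist; so the infimum is a minimum.\<close>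

lemma
  fixes lam l n m k
  assumes "k \<ge> 1"
  defines "I \<equiv> INF (p1, p2) \<in> policies l n m k. finite_cost lam l n p1 p2"
  shows optimal_policy_exists: "\<exists>(p1, p2) \<in> policies l n m k. I = finite_cost lam l n p1 p2"
    and INF_finite_cost_le: "(p1, p2) \<in> policies l n m k \<Longrightarrow> I \<le> finite_cost lam l n p1 p2"
proof -
  let ?S = "(\<lambda>(p1, p2). finite_cost lam l n p1 p2) ` policies l n m k"
  have fin: "finite ?S"
    unfolding policies_def by (intro finite_imageI finite_cartesian_product finite_PiE) auto
  have "act_levels m k \<noteq> {}" using assms(1) by (auto simp: act_levels_def lessThan_empty_iff)
  then have ne: "?S \<noteq> {}"
    by (simp add: policies_def PiE_eq_empty_iff)
  have I: "I = Min ?S" unfolding I_def by (rule cInf_eq_Min[OF fin ne])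
  show "\<exists>(p1, p2) \<in> policies l n m k. I = finite_cost lam l n p1 p2"
    using Min_in[OF fin ne] unfolding I by auto
  show "I \<le> finite_cost lam l n p1 p2" if "(p1, p2) \<in> policies l n m k"
    unfolding I by (rule Min_le[OF fin]) (use that in force)
qed

text \<open>A bounded continuous policy yields a finite one by quantizing its observation and then
  its action; continuity makes these converge to it pointwise.\<close>

lemma limsup_INF_finite_cost_le:
  assumes "lam \<ge> 0" and N: "filterlim N at_top sequentially"
    and g: "continuous_on UNIV g1" "continuous_on UNIV g2" "\<And>y. \<bar>g1 y\<bar> \<le> B" "\<And>y. \<bar>g2 y\<bar> \<le> B"
  shows "limsup (\<lambda>j. ennreal (INF (p1, p2) \<in> policies (grid_bound (N j)) (grid_size (N j)) (grid_bound j) (grid_size j).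
      finite_cost lam (grid_bound (N j)) (grid_size (N j)) p1 p2)) \<le> independent_cost lam g1 g2"
    (is "limsup ?I \<le> _")
proof -
  have "B \<ge> 0" using g(3)[of 0] by simp
  have [measurable]: "g1 \<in> borel_measurable borel" "g2 \<in> borel_measurable borel"
    using g by (auto intro: borel_measurable_continuous_onI)
  define f where "f g j y = grid_quantizer j (g (grid_quantizer (N j) y))" for g j y
  let ?F = "\<lambda>j. \<integral>\<^sup>+ w. ennreal (c_tilde lam (grid_quantizer (N j) (fst w)) (grid_quantizer (N j) (snd w))
      (f g1 j (fst w)) (f g2 j (snd w))) \<partial>(std_gaussian \<Otimes>\<^sub>M std_gaussian)"
  have f_lim: "(\<lambda>j. f g j y) \<longlonglongrightarrow> g y" if "continuous_on UNIV g" for g y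
    unfolding f_def using that
    by (intro grid_quantizer_tendsto filterlim_ident isCont_tendsto_compose[where g = g] N)
      (auto simp: continuous_on_eq_continuous_at)
  have f_bound: "\<bar>f g j y\<bar> \<le> B + 1" if "\<And>y. \<bar>g y\<bar> \<le> B" for g j y
    unfolding f_def using abs_grid_quantizer_le that by (meson add_right_mono order_trans)
  have lim: "?F \<longlonglongrightarrow> independent_cost lam g1 g2"
  proof (rule bounded_cost_tendsto[OF assms(1), where B = "B + 1"])
    show "f g1 j \<in> borel_measurable borel" "f g2 j \<in> borel_measurable borel" for j
      unfolding f_def[abs_def] by measurable
  qed (use \<open>B \<ge> 0\<close> f_lim f_bound g N in \<open>auto intro: abs_grid_quantizer_le grid_quantizer_tendsto\<close>)
  \<comment> \<open>Once \<open>j\<close> exceeds \<open>B\<close>, all actions lie in the range of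
    the action grid. Outside it the quantizer returns 0, which is not an action level since
    \<open>grid_size j\<close> is even.\<close>
  have "\<forall>\<^sub>F j in sequentially. ?I j \<le> ?F j"
    using eventually_ge_at_top[of "nat \<lceil>B\<rceil>"]
  proof eventually_elim
    case (elim j)
    let ?Z = "meas_levels (grid_bound (N j)) (grid_size (N j))"
    define p where "p g = restrict (\<lambda>z. grid_quantizer j (g z)) ?Z" for g
    have "grid_quantizer j (g z) \<in> act_levels (grid_bound j) (grid_size j)" if "\<And>y. \<bar>g y\<bar> \<le> B" for g z
    proof (rule quantizer_inside(1)[OF grid_bound_pos grid_size_pos])
      have "B \<le> real j" using elim by linarith
      then show "g z \<in> {- grid_bound j..grid_bound j}"
        using that[of z] by (simp add: grid_bound_def abs_le_iff)
    qed
    from this[of g1, OF g(3)] this[of g2, OF g(4)]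
    have "(p g1, p g2) \<in> policies (grid_bound (N j)) (grid_size (N j)) (grid_bound j) (grid_size j)"
      by (simp add: policies_def p_def)
    then have "?I j \<le> ennreal (finite_cost lam (grid_bound (N j)) (grid_size (N j)) (p g1) (p g2))"
      by (intro ennreal_leI INF_finite_cost_le grid_size_pos)
    also have "\<dots> = ?F j"
      using quantizer_in_meas_levels[OF grid_bound_pos[of "N j"] grid_size_pos[of "N j"]]
      by (simp add: ennreal_finite_cost[OF assms(1) grid_bound_pos grid_size_pos] p_def f_def)
    finally show ?case .
  qed
  then have "limsup ?I \<le> limsup ?F" by (rule Limsup_mono)
  also have "\<dots> = independent_cost lam g1 g2"
    using lim by (intro lim_imp_Limsup) auto
  finally show ?thesis .
qed

theorem theorem12:
  fixes lam :: real
    and M :: "'w measure" and Y1 V :: "'w \<Rightarrow> real"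
  assumes "lam > 0"
    and "prob_space M"
    and "distributed M lborel Y1 std_normal_density"
    and "distributed M lborel V std_normal_density"
    and "prob_space.indep_var M borel Y1 borel V"
  shows "\<exists>(l :: nat \<Rightarrow> real) (n :: nat \<Rightarrow> nat) (m :: nat \<Rightarrow> real) (k :: nat \<Rightarrow> nat).
    (\<forall>j. l j > 0 \<and> m j > 0 \<and> n j \<ge> 1 \<and> k j \<ge> 1) \<and>
    (\<forall>j. refines_upto_boundary (quantizer_partition (l (Suc j)) (n (Suc j))) (quantizer_partition (l j) (n j))) \<and>
    (\<forall>j. refines_upto_boundary (quantizer_partition (m (Suc j)) (k (Suc j))) (quantizer_partition (m j) (k j))) \<and>
    (\<lambda>j. ennreal (INF (p1, p2) \<in> policies (l j) (n j) (m j) (k j). finite_cost lam (l j) (n j) p1 p2))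
      \<longlonglongrightarrow> opt_cost M Y1 V lam"
proof -
  have lam: "lam \<ge> 0" using assms(1) by simp
  let ?J = "opt_cost M Y1 V lam"
  have J: "?J = (INF (g1, g2) \<in> borel_measurable borel \<times> borel_measurable borel. independent_cost lam g1 g2)"
    unfolding opt_cost_def
    by (intro INF_cong refl) (auto simp: expected_cost_eq_independent_cost[OF assms])
  \<comment> \<open>Finiteness, witnessed by the zero policies, is used below to pass to the limit
    in a difference in \<open>ennreal\<close>.\<close>
  have J_finite: "?J < \<infinity>"
  proof -
    have "?J \<le> independent_cost lam (\<lambda>_. 0) (\<lambda>_. 0)"
      unfolding J by (rule INF_lower2[of "(\<lambda>_. 0, \<lambda>_. 0)"]) auto
    also have "\<dots> \<le> (\<integral>\<^sup>+ w. ennreal (dominating_cost lam 0 w) \<partial>(std_gaussian \<Otimes>\<^sub>M std_gaussian))"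
      unfolding independent_cost_def
    proof (intro nn_integral_mono ennreal_leI)
      show "c_tilde lam (fst w) (snd w) 0 0 \<le> dominating_cost lam 0 w" for w
        using c_tilde_le_dominating_cost[OF lam, of 0 0 0 "fst w" "fst w" "snd w" "snd w"] by simp
    qed
    also have "\<dots> < \<infinity>" by (rule nn_integral_dominating_cost_finite[OF lam])
    finally show ?thesis .
  qed
  have "\<forall>j. \<exists>K. \<forall>N\<ge>K. (\<Sum>u1\<in>act_levels (grid_bound j) (grid_size j). \<Sum>u2\<in>act_levels (grid_bound j) (grid_size j).
      quantized_cost_error lam N u1 u2) \<le> ennreal (1 / real (Suc j))"
    using eventually_sum_quantized_cost_error_le[OF lam] by simp
  then obtain K where K: "\<And>j N. N \<ge> K j \<Longrightarrow>
      (\<Sum>u1\<in>act_levels (grid_bound j) (grid_size j). \<Sum>u2\<in>act_levels (grid_bound j) (grid_size j).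
        quantized_cost_error lam N u1 u2) \<le> ennreal (1 / real (Suc j))"
    by metis
  \<comment> \<open>\<open>N j\<close> is at least \<open>K j\<close>, so the error bound applies;
    it is nondecreasing, so the grids are nested; and it is at least \<open>j\<close>, so it tends
    to infinity.\<close>
  define N where "N j = j + (\<Sum>i\<le>j. K i)" for j
  have N_ge: "K j \<le> N j" for j
    using member_le_sum[of j "{..j}" K] by (simp add: N_def)
  have N_mono: "N j \<le> N (Suc j)" for j by (simp add: N_def)
  have N_lim: "filterlim N at_top sequentially"
    by (rule filterlim_at_top_mono[OF filterlim_ident]) (simp add: N_def)
  define I where "I j = (INF (p1, p2) \<in> policies (grid_bound (N j)) (grid_size (N j)) (grid_bound j) (grid_size j).
      finite_cost lam (grid_bound (N j)) (grid_size (N j)) p1 p2)" for j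
  have "limsup (\<lambda>j. ennreal (I j)) \<le> ?J"
    unfolding J
  proof (rule INF_greatest, clarify)
    fix g1 g2 :: "real \<Rightarrow> real"
    assume "g1 \<in> borel_measurable borel" "g2 \<in> borel_measurable borel"
    then show "limsup (\<lambda>j. ennreal (I j)) \<le> independent_cost lam g1 g2"
      unfolding I_def by (intro le_independent_cost[OF assms(1) limsup_INF_finite_cost_le[OF lam N_lim]])
  qed
  moreover have "?J \<le> liminf (\<lambda>j. ennreal (I j))"
  proof -
    have "?J \<le> ennreal (I j) + ennreal (1 / real (Suc j))" for j
    proof -
      obtain p1 p2 where p: "(p1, p2) \<in> policies (grid_bound (N j)) (grid_size (N j)) (grid_bound j) (grid_size j)"
        and I: "I j = finite_cost lam (grid_bound (N j)) (grid_size (N j)) p1 p2"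
        using optimal_policy_exists[OF grid_size_pos] unfolding I_def by blast
      have "?J \<le> independent_cost lam (\<lambda>y. p1 (grid_quantizer (N j) y)) (\<lambda>y. p2 (grid_quantizer (N j) y))"
        unfolding J by (rule INF_lower2[of "(\<lambda>y. p1 (grid_quantizer (N j) y), \<lambda>y. p2 (grid_quantizer (N j) y))"])
          (auto intro: measurable_comp_quantizer grid_bound_pos grid_size_pos)
      also note independent_cost_le_finite_cost[OF lam p]
      also note K[OF N_ge]
      finally show ?thesis by (simp add: I add_left_mono)
    qed
    then have le: "?J - ennreal (1 / real (Suc j)) \<le> ennreal (I j)" for j
      by (simp add: ennreal_minus_le_iff add.commute)
    have "(\<lambda>j. 1 / real (Suc j)) \<longlonglongrightarrow> 0"
      using LIMSEQ_inverse_real_of_nat by (simp add: inverse_eq_divide)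
    then have "(\<lambda>j. ?J - ennreal (1 / real (Suc j))) \<longlonglongrightarrow> ?J - ennreal 0"
      using J_finite by (intro tendsto_diff_ennreal tendsto_const tendsto_ennrealI) auto
    then have "?J = liminf (\<lambda>j. ?J - ennreal (1 / real (Suc j)))"
      by (simp add: lim_imp_Liminf)
    also have "\<dots> \<le> liminf (\<lambda>j. ennreal (I j))"
      by (rule Liminf_mono, rule always_eventually, rule allI, rule le)
    finally show ?thesis .
  qed
  ultimately have lim: "(\<lambda>j. ennreal (I j)) \<longlonglongrightarrow> ?J"
    using Liminf_le_Limsup[OF sequentially_bot, of "\<lambda>j. ennreal (I j)"]
    by (intro Liminf_eq_Limsup sequentially_bot) (auto intro: antisym order_trans)
  show ?thesis
    by (intro exI[of _ "\<lambda>j. grid_bound (N j)"] exI[of _ "\<lambda>j. grid_size (N j)"] exI[of _ grid_bound] exI[of _ grid_size]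
        conjI allI grid_bound_pos grid_size_pos refines_grid_partition N_mono lim[unfolded I_def] le_SucI order_refl)
qed

end
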